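(* Let $f \in \mathcal{C}_{\mathcal{AP}}$ have the Taylor expansion $f(z)=z+\sum_{n=2}^\infty a_nz^n$, $z\in\mathbb{D}$, and let \[ T_{3,1}(f)=2\,\mathrm{Re}\left(a_{2}^{2}\overline{a_{3}}\right)-2|a_{2}|^{2}-|a_{3}|^{2}+1 \] be its third-order Hermitian–Toeplitz determinant. Then \[ \frac{437}{2304} \le T_{3,1}(f) \le 1. \] These bounds are sharp, i.e. for each of the two inequalities there is a function $f\in\mathcal{C}_{\mathcal{AP}}$ for which equality holds.
   Context: Let $\mathbb{D}=\{z\in\mathbb{C}:|z|<1\}$ and let $\mathcal{A}$ be the class of analytic functions $f$ in $\mathbb{D}$ normalized by $f(0)=0$, $f'(0)=1$, so that $f(z)=z+\sum_{n=2}^\infty a_nz^n$. For analytic $f,g$ in $\mathbb{D}$, $f$ is subordinate to $g$, written $f\prec g$, if there is a Schwarz function $\omega$ (analytic in $\mathbb{D}$, $\omega(0)=0$, $|\omega(z)|<1$ for $z\in\mathbb{D}$) with $f(z)=g(\omega(z))$ for all $z\in\mathbb{D}$. The apple-like convex class $\mathcal{C}_{\mathcal{AP}}$ consists of all $f\in\mathcal{A}$ with $1+\frac{zf''(z)}{f'(z)}\prec \psi_{\mathcal{AP}}(z)$ in $\mathbb{D}$, where $\psi_{\mathcal{AP}}(z)=e^{z}\sqrt{1+z}$ (branch of the square root with $\sqrt{1}=1$). *)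

theory Defs
  imports "HOL-Complex_Analysis.Complex_Analysis"
begin

definition schwarz_function :: "(complex \<Rightarrow> complex) \<Rightarrow> bool" where
  "schwarz_function \<omega> \<longleftrightarrow>
     \<omega> holomorphic_on ball 0 1 \<and> \<omega> 0 = 0 \<and> (\<forall>z\<in>ball 0 1. norm (\<omega> z) < 1)"

definition subordinate :: "(complex \<Rightarrow> complex) \<Rightarrow> (complex \<Rightarrow> complex) \<Rightarrow> bool"
    (infix "\<prec>\<^sub>s" 50) where
  "f \<prec>\<^sub>s g \<longleftrightarrow> f holomorphic_on ball 0 1 \<and> g holomorphic_on ball 0 1 \<and>
     (\<exists>\<omega>. schwarz_function \<omega> \<and> (\<forall>z\<in>ball 0 1. f z = g (\<omega> z)))"

definition class_A :: "(complex \<Rightarrow> complex) set" where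
  "class_A = {f. f holomorphic_on ball 0 1 \<and> f 0 = 0 \<and> deriv f 0 = 1}"

text \<open>\<^const>\<open>csqrt\<close> is the principal branch, holomorphic on the right half-plane
  containing \<open>1 + z\<close>, with \<open>csqrt 1 = 1\<close>.\<close>

definition psi_AP :: "complex \<Rightarrow> complex" where
  "psi_AP z = exp z * csqrt (1 + z)"

text \<open>The quotient \<open>z f''(z) / f'(z)\<close> is understood to be defined throughout the disc;
  since division by zero is total in HOL, \<open>f'(z) \<noteq> 0\<close> is stated explicitly.\<close>

definition C_AP :: "(complex \<Rightarrow> complex) set" where
  "C_AP = {f \<in> class_A. (\<forall>z\<in>ball 0 1. deriv f z \<noteq> 0) \<and>
     (\<lambda>z. 1 + z * deriv (deriv f) z / deriv f z) \<prec>\<^sub>s psi_AP}"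

definition taylor_coeff :: "(complex \<Rightarrow> complex) \<Rightarrow> nat \<Rightarrow> complex" where
  "taylor_coeff f n = fps_nth (fps_expansion f 0) n"

definition T31 :: "(complex \<Rightarrow> complex) \<Rightarrow> real" where
  "T31 f = (let a = taylor_coeff f in
     2 * Re ((a 2)\<^sup>2 * cnj (a 3)) - 2 * (norm (a 2))\<^sup>2 - (norm (a 3))\<^sup>2 + 1)"

end

theory Submission
  imports Defs
begin

text \<open>
  Membership of \<open>f\<close> in the class means \<open>z f''(z) = f'(z) (psi_AP (\<omega> z) - 1)\<close> for some
  Schwarz function \<open>\<omega> z = c\<^sub>1 z + c\<^sub>2 z\<^sup>2 + \<dots>\<close>.
  Since \<open>psi_AP z = 1 + 3/2 z + 7/8 z\<^sup>2 + \<dots>\<close>, comparing coefficients gives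
  \<open>a\<^sub>2 = 3/4 c\<^sub>1\<close> and \<open>a\<^sub>3 = c\<^sub>2 / 4 + 25/48 c\<^sub>1\<^sup>2\<close> (\<open>convex_AP_coeffs\<close>).

  The determinant becomes tractable after completing the square (\<open>T31_eq\<close>):
  \<open>T31 f = (1 - |a\<^sub>2|\<^sup>2)\<^sup>2 - |a\<^sub>3 - a\<^sub>2\<^sup>2|\<^sup>2\<close>.
  Here \<open>|a\<^sub>2|\<^sup>2 = 9/16 u\<close> with \<open>u = |c\<^sub>1|\<^sup>2 \<in> [0, 1]\<close>, which yields the upper bound
  at once. For the lower bound, \<open>a\<^sub>3 - a\<^sub>2\<^sup>2 = c\<^sub>2 / 4 - c\<^sub>1\<^sup>2 / 24\<close>, and the Schwarz-Pick
  inequality \<open>|c\<^sub>2| \<le> 1 - u\<close> (\<open>schwarz_function_factor\<close>) bounds its modulus by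
  \<open>(6 - 5 u) / 24\<close>. The resulting difference of squares factors as
  \<open>(36 - 17 u) / 48 \<cdot> (60 - 37 u) / 48\<close>, a product of positive decreasing functions of
  \<open>u\<close>, so it is smallest at \<open>u = 1\<close>, where it is \<open>19 \<cdot> 23 / 48\<^sup>2 = 437 / 2304\<close>.

  Both bounds are attained: every Schwarz function comes from a member of the class, obtained by
  integrating the differential equation twice (\<open>convex_AP_exists\<close>). The choice \<open>\<omega> z = z\<close>
  gives the lower bound and \<open>\<omega> = 0\<close>, that is \<open>f z = z\<close>, the upper one.
\<close>

section \<open>The second coefficient of a Schwarz function\<close>

text \<open>
  Following \<open>\<phi>\<close> by the Moebius map that sends \<open>\<phi> 0\<close> to \<open>0\<close> produces a map to which the
  Schwarz lemma applies; that Moebius map has derivative \<open>1 / (1 - |\<phi> 0|\<^sup>2)\<close> at \<open>\<phi> 0\<close>.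
\<close>
lemma schwarz_pick_at_0:
  assumes hol: "\<phi> holomorphic_on ball 0 1"
    and less: "\<And>z. norm z < 1 \<Longrightarrow> norm (\<phi> z) < 1"
  shows "norm (deriv \<phi> 0) \<le> 1 - (norm (\<phi> 0))\<^sup>2"
proof -
  define a where "a = \<phi> 0"
  have a: "norm a < 1"
    using less[of 0] by (simp add: a_def)
  have hol': "Moebius_function 0 a \<circ> \<phi> holomorphic_on ball 0 1"
    using less by (intro holomorphic_on_compose_gen[OF hol Moebius_function_holomorphic[OF a]]) auto
  have "norm (deriv (Moebius_function 0 a \<circ> \<phi>) 0) \<le> 1"
  proof (rule Schwarz_Lemma(2)[OF hol', of 0])
    show "(Moebius_function 0 a \<circ> \<phi>) 0 = 0"
      by (simp add: a_def Moebius_function_eq_zero)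
    show "norm ((Moebius_function 0 a \<circ> \<phi>) z) < 1" if "norm z < 1" for z
      using Moebius_function_norm_lt_1[OF a less[OF that]] by simp
  qed simp
  moreover have "deriv (Moebius_function 0 a \<circ> \<phi>) 0 = deriv \<phi> 0 / (1 - (norm a)\<^sup>2)"
  proof (rule DERIV_imp_deriv)
    have d: "(\<phi> has_field_derivative deriv \<phi> 0) (at 0)"
      using hol by (auto intro: holomorphic_derivI)
    have nz: "1 - cnj a * a \<noteq> 0"
    proof -
      have "norm (cnj a * a) < 1"
        using norm_mult_less[of "cnj a" 1 a 1] a by simp
      thus ?thesis by auto
    qed
    have n2: "complex_of_real (1 - (norm a)\<^sup>2) = 1 - cnj a * a"
      by (metis complex_norm_square mult.commute of_real_diff of_real_1)
    have "((\<lambda>z. \<phi> z - a) has_field_derivative deriv \<phi> 0) (at 0)"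
      using DERIV_diff[OF d DERIV_const[of a]] by simp
    moreover have "((\<lambda>z. 1 - cnj a * \<phi> z) has_field_derivative - (cnj a * deriv \<phi> 0)) (at 0)"
      using DERIV_diff[OF DERIV_const[of 1] DERIV_cmult[OF d, of "cnj a"]] by simp
    ultimately have "((\<lambda>z. (\<phi> z - a) / (1 - cnj a * \<phi> z)) has_field_derivative
        (deriv \<phi> 0 * (1 - cnj a * a) - (a - a) * - (cnj a * deriv \<phi> 0)) /
        ((1 - cnj a * a) * (1 - cnj a * a))) (at 0)"
      unfolding a_def by (rule DERIV_divide) (use nz in \<open>simp add: a_def\<close>)
    moreover have "(deriv \<phi> 0 * (1 - cnj a * a) - (a - a) * - (cnj a * deriv \<phi> 0)) /
        ((1 - cnj a * a) * (1 - cnj a * a)) = deriv \<phi> 0 / (1 - cnj a * a)"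
      using nz by simp
    ultimately show "(Moebius_function 0 a \<circ> \<phi> has_field_derivative
        deriv \<phi> 0 / (1 - (norm a)\<^sup>2)) (at 0)"
      by (simp only: o_def Moebius_function_simple n2)
  qed
  moreover have "1 - (norm a)\<^sup>2 > 0"
    using a by (simp add: power_less_one_iff)
  ultimately show ?thesis
    by (simp only: norm_divide norm_of_real a_def[symmetric]) simp
qed

text \<open>
  The values \<open>\<phi> 0\<close> and \<open>deriv \<phi> 0\<close> are the first two Taylor coefficients of \<open>\<omega>\<close>. By the
  Schwarz lemma \<open>|\<omega> z / z| < 1\<close> throughout, and Schwarz-Pick applies to the quotient, unless
  \<open>\<omega>\<close> is a rotation; then the quotient is a constant of modulus one and both sides of the
  bound are zero.
\<close>
lemma schwarz_function_factor:
  assumes "schwarz_function \<omega>"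
  obtains \<phi> where "\<phi> holomorphic_on ball 0 1"
    and "\<And>z. norm z < 1 \<Longrightarrow> \<omega> z = z * \<phi> z"
    and "norm (deriv \<phi> 0) \<le> 1 - (norm (\<phi> 0))\<^sup>2"
proof -
  have hol: "\<omega> holomorphic_on ball 0 1" and \<omega>0: "\<omega> 0 = 0"
    and less: "\<And>z. norm z < 1 \<Longrightarrow> norm (\<omega> z) < 1"
    using assms by (auto simp: schwarz_function_def)
  obtain h where h: "h holomorphic_on ball 0 1" "\<And>z. norm z < 1 \<Longrightarrow> \<omega> z = z * h z" "deriv \<omega> 0 = h 0"
    using Schwarz3[OF hol \<omega>0] by blast
  note SL = Schwarz_Lemma[OF hol \<omega>0 less]
  show thesis
  proof (cases "\<forall>z. norm z < 1 \<longrightarrow> norm (h z) < 1")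
    case True
    thus thesis using that[OF h(1,2)] schwarz_pick_at_0[OF h(1)] by blast
  next
    case False
    then obtain w where w: "norm w < 1" "norm (h w) \<ge> 1" by force
    have "(\<exists>z. norm z < 1 \<and> z \<noteq> 0 \<and> norm (\<omega> z) = norm z) \<or> norm (deriv \<omega> 0) = 1"
    proof (cases "w = 0")
      case True
      thus ?thesis using w SL(2)[of 0] h(3) by force
    next
      case False
      have "norm (\<omega> w) \<ge> norm w"
        using h(2)[OF w(1)] w(2) by (simp add: norm_mult mult_le_cancel_left1)
      thus ?thesis using w SL(1)[of w] False by force
    qed
    then obtain \<alpha> where \<alpha>: "\<And>z. norm z < 1 \<Longrightarrow> \<omega> z = \<alpha> * z" "norm \<alpha> = 1"
      using SL(3)[of 0] by auto
    show thesis
      by (rule that[of "\<lambda>_. \<alpha>"]) (use \<alpha> in \<open>auto simp: mult.commute\<close>)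
  qed
qed

section \<open>Taylor coefficients in terms of the Schwarz function\<close>

lemma psi_AP_holomorphic: "psi_AP holomorphic_on ball 0 1"
proof -
  have "1 + z \<notin> \<real>\<^sub>\<le>\<^sub>0" if "norm z < 1" for z :: complex
    using that abs_Re_le_cmod[of z] by (auto simp: complex_nonpos_Reals_iff)
  thus ?thesis
    unfolding psi_AP_def by (intro holomorphic_intros) auto
qed

lemma psi_AP_0 [simp]: "psi_AP 0 = 1"
  by (simp add: psi_AP_def)

lemma psi_AP_has_fps_expansion: "psi_AP has_fps_expansion fps_exp 1 * fps_binomial (1/2)"
  unfolding psi_AP_def[abs_def] csqrt_conv_powr
  by (intro fps_expansion_intros)

lemma psi_AP_coeffs:
  fixes P :: "complex fps"
  defines "P \<equiv> fps_exp 1 * fps_binomial (1/2)"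
  shows "fps_nth P 0 = 1" "fps_nth P 1 = 3/2" "fps_nth P 2 = 7/8"
  by (simp_all add: P_def fps_mult_nth numeral_2_eq_2 gbinomial_Suc_rec
        gbinomial_Suc atLeast0_atMost_Suc field_simps)

text \<open>
  Write \<open>\<phi> z = c\<^sub>1 + c\<^sub>2 z + \<dots>\<close>. The series of \<open>psi_AP (z \<phi> z) - 1\<close> starts with
  \<open>3/2 c\<^sub>1 z + (3/2 c\<^sub>2 + 7/8 c\<^sub>1\<^sup>2) z\<^sup>2\<close>, so the coefficients of \<open>z\<close> and \<open>z\<^sup>2\<close> in
  \<open>z f''(z) = f'(z) (psi_AP (z \<phi> z) - 1)\<close> give \<open>2 a\<^sub>2 = 3/2 c\<^sub>1\<close> and
  \<open>6 a\<^sub>3 = 3/2 c\<^sub>2 + 7/8 c\<^sub>1\<^sup>2 + 2 a\<^sub>2 \<cdot> 3/2 c\<^sub>1\<close>.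
\<close>
lemma convex_AP_coeffs:
  assumes f: "f \<in> class_A" and \<phi>: "\<phi> holomorphic_on ball 0 1"
    and nz: "\<And>z. norm z < 1 \<Longrightarrow> deriv f z \<noteq> 0"
    and eq: "\<And>z. norm z < 1 \<Longrightarrow> 1 + z * deriv (deriv f) z / deriv f z = psi_AP (z * \<phi> z)"
  shows "taylor_coeff f 2 = 3/4 * \<phi> 0"
    and "taylor_coeff f 3 = deriv \<phi> 0 / 4 + 25/48 * (\<phi> 0)\<^sup>2"
proof -
  define F where "F = fps_expansion f 0"
  define H where "H = fps_expansion \<phi> 0"
  define P :: "complex fps" where "P = fps_exp 1 * fps_binomial (1/2)"
  have F: "f has_fps_expansion F" and H: "\<phi> has_fps_expansion H"
    using f \<phi> unfolding F_def H_def class_A_def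
    by (auto intro!: analytic_at_imp_has_fps_expansion_0 simp: analytic_at)
       (metis centre_in_ball open_ball zero_less_one)+
  have F1: "fps_nth F 1 = 1" and H0: "fps_nth H 0 = \<phi> 0" and H1: "fps_nth H 1 = deriv \<phi> 0"
    using f by (simp_all add: F_def H_def fps_expansion_def class_A_def)
  have P: "fps_nth P 0 = 1" "fps_nth P (Suc 0) = 3/2" "fps_nth P 2 = 7/8"
    using psi_AP_coeffs by (simp_all add: P_def)
  have "(psi_AP \<circ> (\<lambda>z. z * \<phi> z)) has_fps_expansion (P oo (fps_X * H))"
    unfolding P_def by (intro has_fps_expansion_compose psi_AP_has_fps_expansion fps_expansion_intros H) auto
  hence rhs: "(\<lambda>z. deriv f z * ((psi_AP \<circ> (\<lambda>z. z * \<phi> z)) z - 1))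
           has_fps_expansion fps_deriv F * ((P oo (fps_X * H)) - 1)"
    by (intro has_fps_expansion_mult has_fps_expansion_diff has_fps_expansion_deriv
          has_fps_expansion_1 F)
  have lhs: "(\<lambda>z. z * deriv (deriv f) z) has_fps_expansion fps_X * fps_deriv (fps_deriv F)"
    by (intro fps_expansion_intros F)
  \<comment> \<open>Clearing the denominator turns the hypothesis into an identity of power series that needs
      no division.\<close>
  have "eventually (\<lambda>z. z * deriv (deriv f) z = deriv f z * ((psi_AP \<circ> (\<lambda>z. z * \<phi> z)) z - 1)) (nhds 0)"
  proof -
    have "eventually (\<lambda>z::complex. z \<in> ball 0 1) (nhds 0)"
      by (intro eventually_nhds_in_open) auto
    thus ?thesis
    proof eventually_elim
      case (elim z)
      hence "norm z < 1" by simp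
      from eq[OF this] nz[OF this] show ?case by (auto simp: field_simps)
    qed
  qed
  from has_fps_expansion_cong[OF this refl] lhs
  have "(\<lambda>z. deriv f z * ((psi_AP \<circ> (\<lambda>z. z * \<phi> z)) z - 1))
          has_fps_expansion fps_X * fps_deriv (fps_deriv F)"
    by (rule iffD1)
  with rhs have fps_eq: "fps_deriv F * ((P oo (fps_X * H)) - 1) = fps_X * fps_deriv (fps_deriv F)"
    by (rule fps_expansion_unique_complex)
  define Q where "Q = P oo (fps_X * H)"
  have Q: "fps_nth Q 0 = 1" "fps_nth Q (Suc 0) = 3/2 * \<phi> 0"
          "fps_nth Q 2 = 3/2 * deriv \<phi> 0 + 7/8 * (\<phi> 0)\<^sup>2"
    unfolding P[symmetric] using P(1) H0 H1
    by (simp_all add: Q_def fps_compose_nth numeral_2_eq_2 atLeast0_atMost_Suc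
        power_mult_distrib fps_mult_nth power2_eq_square)
  have "fps_nth (fps_deriv F * (Q - 1)) 1 = fps_nth (fps_X * fps_deriv (fps_deriv F)) 1"
    using fps_eq by (simp add: Q_def)
  hence F2: "2 * fps_nth F 2 = 3/2 * \<phi> 0"
    using F1 Q by (simp add: fps_mult_nth numeral_2_eq_2 atLeast0_atMost_Suc)
  have "fps_nth (fps_deriv F * (Q - 1)) 2 = fps_nth (fps_X * fps_deriv (fps_deriv F)) 2"
    using fps_eq by (simp add: Q_def)
  hence F3: "6 * fps_nth F 3 = fps_nth Q 2 + 2 * fps_nth F 2 * fps_nth Q (Suc 0)"
    using F1 Q(1) by (simp add: fps_mult_nth numeral_2_eq_2 numeral_3_eq_3 atLeast0_atMost_Suc add.commute)
  show "taylor_coeff f 2 = 3/4 * \<phi> 0"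
    using F2 by (simp add: taylor_coeff_def F_def field_simps)
  show "taylor_coeff f 3 = deriv \<phi> 0 / 4 + 25/48 * (\<phi> 0)\<^sup>2"
    using F3 Q unfolding F2 by (simp add: taylor_coeff_def F_def power2_eq_square field_simps)
qed

section \<open>Functions with a prescribed Schwarz function\<close>

text \<open>
  The quotient \<open>q z = (psi_AP (\<omega> z) - 1) / z\<close> has a removable singularity at \<open>0\<close>, and the
  equation to solve says that \<open>q\<close> is the logarithmic derivative of \<open>f'\<close>. So \<open>f'\<close> is the
  exponential of a primitive of \<open>q\<close>, which makes it zero-free, and \<open>f\<close> is a primitive of that
  exponential; the constants of integration are fixed by \<open>f 0 = 0\<close> and \<open>f' 0 = 1\<close>.
\<close>
lemma convex_AP_exists:
  assumes "schwarz_function \<omega>"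
  obtains f where "f \<in> C_AP"
    and "\<And>z. norm z < 1 \<Longrightarrow> 1 + z * deriv (deriv f) z / deriv f z = psi_AP (\<omega> z)"
proof -
  have hol: "\<omega> holomorphic_on ball 0 1" and \<omega>0: "\<omega> 0 = 0"
    and less: "\<And>z. norm z < 1 \<Longrightarrow> norm (\<omega> z) < 1"
    using assms by (auto simp: schwarz_function_def)
  have "psi_AP \<circ> \<omega> holomorphic_on ball 0 1"
    by (rule holomorphic_on_compose_gen[OF hol psi_AP_holomorphic]) (use less in auto)
  hence holp: "(\<lambda>z. psi_AP (\<omega> z)) holomorphic_on ball 0 1"
    by (simp add: o_def)
  obtain q where q: "q holomorphic_on ball 0 1" "\<And>z. norm z < 1 \<Longrightarrow> psi_AP (\<omega> z) - 1 = z * q z"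
  proof (rule Schwarz3[of "\<lambda>z. psi_AP (\<omega> z) - 1" 1])
    show "(\<lambda>z. psi_AP (\<omega> z) - 1) holomorphic_on ball 0 1"
      by (intro holomorphic_intros holp)
  qed (use \<omega>0 in auto)
  obtain g where g: "\<And>z. z \<in> ball 0 1 \<Longrightarrow> (g has_field_derivative q z) (at z within ball 0 1)"
    using holomorphic_convex_primitive'[OF convex_ball open_ball q(1)] by blast
  have g': "(g has_field_derivative q z) (at z)" if "norm z < 1" for z
    using g[of z] that by (simp add: at_within_open[of _ "ball 0 1"])
  define k where "k = (\<lambda>z. exp (g z - g 0))"
  have k': "(k has_field_derivative k z * q z) (at z)" if "norm z < 1" for z
    unfolding k_def by (rule derivative_eq_intros g'[OF that] refl | simp)+
  have holk: "k holomorphic_on ball 0 1"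
    unfolding holomorphic_on_open[OF open_ball] using k' by (meson mem_ball_0)
  obtain h where h: "\<And>z. z \<in> ball 0 1 \<Longrightarrow> (h has_field_derivative k z) (at z within ball 0 1)"
    using holomorphic_convex_primitive'[OF convex_ball open_ball holk] by blast
  define f where "f = (\<lambda>z. h z - h 0)"
  have f': "(f has_field_derivative k z) (at z)" if "norm z < 1" for z
    using h[of z] that unfolding f_def
    by (auto intro!: derivative_eq_intros simp: at_within_open[of _ "ball 0 1"])
  have df: "deriv f z = k z" if "norm z < 1" for z
    using f'[OF that] by (rule DERIV_imp_deriv)
  have ddf: "deriv (deriv f) z = k z * q z" if "norm z < 1" for z
  proof -
    have "(deriv f has_field_derivative k z * q z) (at z)"
      by (rule has_field_derivative_transform_within_open[OF k'[OF that] open_ball[of 0 1]])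
         (use that df in auto)
    thus ?thesis by (rule DERIV_imp_deriv)
  qed
  have nz: "k z \<noteq> 0" for z by (simp add: k_def)
  have eq: "1 + z * deriv (deriv f) z / deriv f z = psi_AP (\<omega> z)" if "norm z < 1" for z
    using q(2)[OF that] df[OF that] ddf[OF that] nz[of z] by (simp add: algebra_simps)
  have "f holomorphic_on ball 0 1"
    unfolding holomorphic_on_open[OF open_ball] using f' by (meson mem_ball_0)
  hence "f \<in> class_A"
    using df[of 0] by (simp add: class_A_def f_def k_def)
  moreover have "(\<lambda>z. 1 + z * deriv (deriv f) z / deriv f z) holomorphic_on ball 0 1"
    by (rule holomorphic_transform[OF holp]) (use eq in auto)
  ultimately have "f \<in> C_AP"
    using df nz eq assms psi_AP_holomorphic by (auto simp: C_AP_def subordinate_def)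
  thus thesis using that eq by blast
qed

section \<open>The determinant\<close>

text \<open>
  This replaces the term \<open>2 Re (a\<^sub>2\<^sup>2 cnj a\<^sub>3) - |a\<^sub>3|\<^sup>2\<close> by
  \<open>|a\<^sub>2|\<^sup>4 - |a\<^sub>3 - a\<^sub>2\<^sup>2|\<^sup>2\<close>, so that the arguments of the coefficients enter only
  through a single modulus.
\<close>
lemma T31_eq:
  "T31 f = (1 - (norm (taylor_coeff f 2))\<^sup>2)\<^sup>2 - (norm (taylor_coeff f 3 - (taylor_coeff f 2)\<^sup>2))\<^sup>2"
proof -
  have "(norm (b - s))\<^sup>2 = (norm b)\<^sup>2 + (norm s)\<^sup>2 - 2 * Re (s * cnj b)" for b s :: complex
    by (simp add: cmod_power2) (simp add: power2_eq_square algebra_simps)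
  thus ?thesis
    by (simp add: T31_def Let_def norm_power) (simp add: power2_eq_square power4_eq_xxxx algebra_simps)
qed

lemma T31_bounds:
  assumes "f \<in> C_AP"
  shows "437 / 2304 \<le> T31 f" "T31 f \<le> 1"
proof -
  obtain \<omega> where \<omega>: "schwarz_function \<omega>"
    "\<And>z. norm z < 1 \<Longrightarrow> 1 + z * deriv (deriv f) z / deriv f z = psi_AP (\<omega> z)"
    using assms by (auto simp: C_AP_def subordinate_def)
  obtain \<phi> where \<phi>: "\<phi> holomorphic_on ball 0 1" "\<And>z. norm z < 1 \<Longrightarrow> \<omega> z = z * \<phi> z"
    "norm (deriv \<phi> 0) \<le> 1 - (norm (\<phi> 0))\<^sup>2"
    using schwarz_function_factor[OF \<omega>(1)] by metis
  define u where "u = (norm (\<phi> 0))\<^sup>2"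
  have u: "0 \<le> u" "u \<le> 1"
    using \<phi>(3) norm_ge_zero[of "deriv \<phi> 0"] unfolding u_def by (simp, linarith)
  have coeffs: "taylor_coeff f 2 = 3/4 * \<phi> 0" "taylor_coeff f 3 = deriv \<phi> 0 / 4 + 25/48 * (\<phi> 0)\<^sup>2"
    by (rule convex_AP_coeffs[OF _ \<phi>(1)]; use assms \<omega>(2) \<phi>(2) in \<open>force simp: C_AP_def\<close>)+
  define d where "d = norm (taylor_coeff f 3 - (taylor_coeff f 2)\<^sup>2)"
  have T: "T31 f = (1 - 9/16 * u)\<^sup>2 - d\<^sup>2"
    by (simp add: T31_eq d_def u_def coeffs(1) norm_mult power_mult_distrib power_divide)
  have "taylor_coeff f 3 - (taylor_coeff f 2)\<^sup>2 = deriv \<phi> 0 / 4 - (\<phi> 0)\<^sup>2 / 24"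
    by (simp add: coeffs power2_eq_square field_simps)
  hence "d \<le> norm (deriv \<phi> 0 / 4) + norm ((\<phi> 0)\<^sup>2 / 24)"
    unfolding d_def by (metis norm_triangle_ineq4)
  also have "\<dots> \<le> (1 - u) / 4 + u / 24"
    using \<phi>(3) by (simp add: norm_divide norm_power u_def)
  finally have d: "d \<le> (6 - 5 * u) / 24" by argo
  have "d\<^sup>2 \<le> ((6 - 5 * u) / 24)\<^sup>2"
    using d by (intro power_mono) (auto simp: d_def)
  moreover have "(1 - 9/16 * u)\<^sup>2 - ((6 - 5 * u) / 24)\<^sup>2 = (36 - 17 * u) / 48 * ((60 - 37 * u) / 48)"
    by (simp add: power2_eq_square field_simps)
  moreover have "(36 - 17 * u) / 48 * ((60 - 37 * u) / 48) \<ge> (36 - 17) / 48 * ((60 - 37) / 48)"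
    using u by (intro mult_mono) auto
  ultimately show "437 / 2304 \<le> T31 f" using T by simp
  have "(1 - 9/16 * u)\<^sup>2 \<le> 1\<^sup>2"
    using u by (intro power_mono) auto
  thus "T31 f \<le> 1" using T zero_le_power2[of d] unfolding one_power2 by linarith
qed

theorem theorem7p1:
  shows "(\<forall>f\<in>C_AP. 437 / 2304 \<le> T31 f \<and> T31 f \<le> 1) \<and>
         (\<exists>f\<in>C_AP. T31 f = 437 / 2304) \<and>
         (\<exists>f\<in>C_AP. T31 f = 1)"
proof -
  \<comment> \<open>The member of the class with Schwarz function \<open>c z\<close>: in \<open>convex_AP_coeffs\<close> the factor
      \<open>\<phi>\<close> is then the constant \<open>c\<close>.\<close>
  have extremal: "\<exists>f\<in>C_AP. taylor_coeff f 2 = 3/4 * c \<and> taylor_coeff f 3 = 25/48 * c\<^sup>2"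
    if c: "norm c \<le> 1" for c :: complex
  proof -
    have "norm (z * c) < 1" if "norm z < 1" for z
      using mult_left_mono[OF c norm_ge_zero[of z]] that by (simp add: norm_mult)
    hence "schwarz_function (\<lambda>z. z * c)"
      by (auto simp: schwarz_function_def intro!: holomorphic_intros)
    then obtain f where f: "f \<in> C_AP"
      "\<And>z. norm z < 1 \<Longrightarrow> 1 + z * deriv (deriv f) z / deriv f z = psi_AP (z * c)"
      using convex_AP_exists by blast
    have nz: "f \<in> class_A" "\<And>z. norm z < 1 \<Longrightarrow> deriv f z \<noteq> 0"
      using f(1) by (auto simp: C_AP_def)
    show ?thesis
      using convex_AP_coeffs[OF nz(1) holomorphic_on_const nz(2) f(2)] f(1) by auto
  qed
  obtain f where f: "f \<in> C_AP" "taylor_coeff f 2 = 3/4" "taylor_coeff f 3 = 25/48"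
    using extremal[of 1] by auto
  obtain g where g: "g \<in> C_AP" "taylor_coeff g 2 = 0" "taylor_coeff g 3 = 0"
    using extremal[of 0] by auto
  have "T31 f = 437 / 2304"
    by (simp add: T31_eq f power2_eq_square)
  moreover have "T31 g = 1"
    by (simp add: T31_eq g)
  ultimately show ?thesis
    using T31_bounds f(1) g(1) by blast
qed

end
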